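(* Let $(\Omega,\mathbb{F})$ be a measurable space, let $\mu$ be a $\sigma$-finite measure on $(\Omega,\mathbb{F})$, and let $P_n$, $n=1,2,\ldots$, be a sequence of probability measures on $(\Omega,\mathbb{F})$ that have densities $f_n$ with respect to $\mu$. Assume that the densities $f_n$ converge pointwise $\mu$-almost everywhere to a probability density $f$ with respect to $\mu$. Let $P$ denote the probability measure with density $f$ with respect to $\mu$, and let $\mathbb{A}$, $\mathbb{B}$, and $\mathbb{H}$ be sub-$\sigma$-algebras of $\mathbb{F}$. If $\mathbb{A}$ and $\mathbb{B}$ are conditionally independent given $\mathbb{H}$ with respect to $P_n$ for all $n$, then $\mathbb{A}$ and $\mathbb{B}$ are conditionally independent given $\mathbb{H}$ with respect to $P$.
   Context: Probability measures are $\sigma$-additive. A probability density with respect to $\mu$ is a nonnegative $\mathbb{F}$-measurable function $f$ with $\int_\Omega f\,d\mu=1$; the probability measure with density $f$ is $F\mapsto\int_F f\,d\mu$, $F\in\mathbb{F}$. For a probability measure $Q$ on $(\Omega,\mathbb{F})$, a sub-$\sigma$-algebra $\mathbb{H}\subseteq\mathbb{F}$ and $A\in\mathbb{F}$, the conditional probability $Q(A\,|\,\mathbb{H})$ is the conditional expectation under $Q$ of the indicator function $\mathbf{1}_A$ given $\mathbb{H}$. Sub-$\sigma$-algebras $\mathbb{A},\mathbb{B}\subseteq\mathbb{F}$ are conditionally independent given $\mathbb{H}$ with respect to $Q$ if for all $A\in\mathbb{A}$ and $B\in\mathbb{B}$, $Q(A\cap B\,|\,\mathbb{H})=Q(A\,|\,\mathbb{H})\,Q(B\,|\,\mathbb{H})$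 $Q$-almost surely. *)

theory Defs
  imports "HOL-Probability.Probability"
begin

definition prob_density :: "'a measure \<Rightarrow> ('a \<Rightarrow> real) \<Rightarrow> bool" where
  "prob_density M f \<longleftrightarrow>
     f \<in> borel_measurable M \<and> (\<forall>x\<in>space M. 0 \<le> f x) \<and> integrable M f \<and> (\<integral>x. f x \<partial>M) = 1"

(* As for real_cond_exp, a sub-sigma-algebra is represented by a measure H with subalgebra Q H;
   only sets H and space H matter, never the values of emeasure H. *)

definition sub_cond_prob :: "'a measure \<Rightarrow> 'a measure \<Rightarrow> 'a set \<Rightarrow> 'a \<Rightarrow> real" where
  "sub_cond_prob Q H A = real_cond_exp Q H (indicator A)"

definition cond_indep_subalg ::
    "'a measure \<Rightarrow> 'a measure \<Rightarrow> 'a measure \<Rightarrow> 'a measure \<Rightarrow> bool" where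
  "cond_indep_subalg Q H \<A> \<B> \<longleftrightarrow>
     (\<forall>A\<in>sets \<A>. \<forall>B\<in>sets \<B>. AE x in Q.
        sub_cond_prob Q H (A \<inter> B) x = sub_cond_prob Q H A x * sub_cond_prob Q H B x)"

end

theory Submission
  imports Defs
begin

text \<open>
  By Scheffe's lemma the densities converge in \<open>L\<^sup>1(\<mu>)\<close>, so the measures converge in total
  variation: with \<open>e\<^sub>n = \<integral>\<bar>f\<^sub>n - f\<bar> d\<mu>\<close>, the integrals of any measurable \<open>\<phi>\<close> with
  \<open>\<bar>\<phi>\<bar> \<le> 1\<close> under \<open>P\<^sub>n\<close> and under \<open>P\<close> differ by at most \<open>e\<^sub>n\<close>.

  Conditional probabilities are Lipschitz in this distance, once they are compared in
  \<open>L\<^sup>1(P)\<close>.  Let \<open>g\<^sub>n\<close> and \<open>g\<close> be \<open>[0,1]\<close>-valued versions of \<open>P\<^sub>n(A | H)\<close> and \<open>P(A | H)\<close>, and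
  let \<open>h\<close> be \<open>H\<close>-measurable with \<open>\<bar>h\<bar> \<le> 1\<close>.  In the chain
  \<open>\<integral>h g\<^sub>n dP \<approx> \<integral>h g\<^sub>n dP\<^sub>n = \<integral>h 1\<^sub>A dP\<^sub>n \<approx> \<integral>h 1\<^sub>A dP = \<integral>h g dP\<close>
  each approximation costs at most \<open>e\<^sub>n\<close>.  The choice \<open>h = sgn (g\<^sub>n - g)\<close> gives
  \<open>\<integral>\<bar>g\<^sub>n - g\<bar> dP \<le> 2 e\<^sub>n\<close> (lemma \<open>cond_prob_L1_dist\<close>).

  Let \<open>a\<close>, \<open>b\<close>, \<open>c\<close> be the versions under \<open>P\<close> for \<open>A\<close>, \<open>B\<close>, \<open>A \<inter> B\<close>.  Conditional independence
  under \<open>P\<^sub>n\<close> says \<open>c\<^sub>n = a\<^sub>n b\<^sub>n\<close> almost surely, and multiplication is Lipschitz on \<open>[0,1]\<close>, so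
  \<open>\<integral>\<bar>c - a b\<bar> dP \<le> 7 e\<^sub>n\<close> (lemma \<open>cond_indep_defect\<close>).  The left-hand side does not
  depend on \<open>n\<close>, hence it is zero.
\<close>

section \<open>Bounded versions of conditional probabilities\<close>

text \<open>
  The function \<open>sub_cond_prob Q H A\<close> is known to lie in \<open>[0,1]\<close> only off a \<open>Q\<close>-null set, which need not
  be null for another measure.  Bounded versions can be integrated against both measures.
\<close>

definition cond_prob_version ::
    "'a measure \<Rightarrow> 'a measure \<Rightarrow> 'a set \<Rightarrow> ('a \<Rightarrow> real) \<Rightarrow> bool" where
  "cond_prob_version Q H A g \<longleftrightarrow>
     g \<in> borel_measurable H \<and> (\<forall>x. 0 \<le> g x \<and> g x \<le> 1) \<and> (AE x in Q. sub_cond_prob Q H A x = g x)"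

lemma prob_space_sigma_finite_subalgebra:
  assumes "prob_space Q" "subalgebra Q H"
  shows "sigma_finite_subalgebra Q H"
  using assms
  by (intro finite_measure_subalgebra_is_sigma_finite finite_measure_subalgebra.intro
      finite_measure_subalgebra_axioms.intro prob_space.finite_measure)

lemma ex_cond_prob_version:
  assumes "prob_space Q" "subalgebra Q H" and A: "A \<in> sets Q"
  shows "\<exists>g. cond_prob_version Q H A g"
proof -
  interpret Q: prob_space Q by fact
  interpret sigma_finite_subalgebra Q H
    by (rule prob_space_sigma_finite_subalgebra) fact+
  let ?c = "sub_cond_prob Q H A"
  let ?g = "\<lambda>x. max 0 (min 1 (?c x))"
  have int: "integrable Q (indicator A :: _ \<Rightarrow> real)"
    using A by (simp add: less_top[symmetric])
  have [measurable]: "?c \<in> borel_measurable H"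
    unfolding sub_cond_prob_def by measurable
  have "AE x in Q. ?c x \<ge> 0" "AE x in Q. ?c x \<le> 1"
    unfolding sub_cond_prob_def
    using real_cond_exp_ge_c[OF int, of 0] real_cond_exp_le_c[OF int, of 1] by auto
  then have "AE x in Q. ?c x = ?g x" by eventually_elim auto
  then have "cond_prob_version Q H A ?g"
    unfolding cond_prob_version_def by auto
  then show ?thesis by blast
qed

lemma cond_prob_version_integral:
  fixes h :: "'a \<Rightarrow> real"
  assumes "prob_space Q" and sub: "subalgebra Q H" and A[measurable]: "A \<in> sets Q"
    and g: "cond_prob_version Q H A g"
    and h[measurable]: "h \<in> borel_measurable H" and bound: "\<And>x. \<bar>h x\<bar> \<le> 1"
  shows "(\<integral>x. h x * g x \<partial>Q) = (\<integral>x. h x * indicator A x \<partial>Q)"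
proof -
  interpret Q: prob_space Q by fact
  interpret sigma_finite_subalgebra Q H
    by (rule prob_space_sigma_finite_subalgebra) fact+
  have [measurable]: "h \<in> borel_measurable Q" "g \<in> borel_measurable Q"
    using g measurable_from_subalg[OF sub h]
    by (auto simp: cond_prob_version_def intro: measurable_from_subalg[OF sub])
  have "(\<integral>x. h x * g x \<partial>Q) = (\<integral>x. h x * real_cond_exp Q H (indicator A) x \<partial>Q)"
    using g by (intro integral_cong_AE) (auto simp: cond_prob_version_def sub_cond_prob_def)
  also have "\<dots> = (\<integral>x. h x * indicator A x \<partial>Q)"
    using bound
    by (intro real_cond_exp_intg Q.integrable_const_bound[where B = 1])
       (auto simp: abs_mult indicator_def)
  finally show ?thesis .
qed

section \<open>Stability under total variation\<close>

text \<open>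
  The bound on \<open>\<bar>\<integral>\<phi> dP - \<integral>\<phi> dQ\<bar>\<close> expresses closeness in total variation, in the dual form
  in which it is used.
\<close>

locale tv_close = P: prob_space P + Q: prob_space Q
  for P Q :: "'a measure" and H :: "'a measure" and e :: real +
  assumes sets_eq [measurable_cong]: "sets P = sets Q"
    and subP: "subalgebra P H" and subQ: "subalgebra Q H"
    and close: "\<And>\<phi> :: 'a \<Rightarrow> real. \<phi> \<in> borel_measurable Q \<Longrightarrow> (\<And>x. \<bar>\<phi> x\<bar> \<le> 1)
                  \<Longrightarrow> \<bar>(\<integral>x. \<phi> x \<partial>P) - (\<integral>x. \<phi> x \<partial>Q)\<bar> \<le> e"
begin

text \<open>
  An \<open>L\<^sup>1\<close> norm is an integral against a sign, and the sign of \<open>g' - g\<close> is itself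
  \<open>H\<close>-measurable.  So both versions may be replaced by the indicator of \<open>A\<close>, each under its
  own measure; the two changes of measure cost \<open>e\<close> each.
\<close>

lemma cond_prob_L1_dist:
  assumes A: "A \<in> sets Q"
    and g': "cond_prob_version P H A g'" and g: "cond_prob_version Q H A g"
  shows "(\<integral>x. \<bar>g' x - g x\<bar> \<partial>Q) \<le> 2 * e"
proof -
  define h where "h x = sgn (g' x - g x)" for x
  have b: "0 \<le> g' x" "g' x \<le> 1" "0 \<le> g x" "g x \<le> 1" for x
    using g g' by (auto simp: cond_prob_version_def)
  have hb: "\<bar>h x\<bar> \<le> 1" for x by (simp add: h_def sgn_real_def)
  have [measurable]: "g' \<in> borel_measurable H" "g \<in> borel_measurable H"
    using g g' by (auto simp: cond_prob_version_def)
  have hH: "h \<in> borel_measurable H" unfolding h_def sgn_real_def by measurable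
  have [measurable]: "g' \<in> borel_measurable Q" "g \<in> borel_measurable Q" "h \<in> borel_measurable Q"
    using hH by (auto intro: measurable_from_subalg[OF subQ])
  note [measurable] = A
  have hb': "\<bar>h x * g' x\<bar> \<le> 1" "\<bar>h x * g x\<bar> \<le> 1" "\<bar>h x * indicator A x\<bar> \<le> 1" for x
    using hb[of x] b[of x] by (auto simp: abs_mult indicator_def intro: mult_le_one)
  have "(\<integral>x. \<bar>g' x - g x\<bar> \<partial>Q) = (\<integral>x. h x * g' x - h x * g x \<partial>Q)"
    by (intro Bochner_Integration.integral_cong)
       (auto simp: h_def sgn_real_def)
  also have "\<dots> = (\<integral>x. h x * g' x \<partial>Q) - (\<integral>x. h x * g x \<partial>Q)"
    using hb' by (intro Bochner_Integration.integral_diff Q.integrable_const_bound[where B = 1]) auto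
  also have "(\<integral>x. h x * g x \<partial>Q) = (\<integral>x. h x * indicator A x \<partial>Q)"
    by (rule cond_prob_version_integral[OF Q.prob_space_axioms subQ A g hH hb])
  finally have "(\<integral>x. \<bar>g' x - g x\<bar> \<partial>Q) = (\<integral>x. h x * g' x \<partial>Q) - (\<integral>x. h x * indicator A x \<partial>Q)" .
  moreover have "(\<integral>x. h x * g' x \<partial>P) = (\<integral>x. h x * indicator A x \<partial>P)"
    using cond_prob_version_integral[OF P.prob_space_axioms subP _ g' hH hb] A
    by (simp add: sets_eq)
  moreover have "\<bar>(\<integral>x. h x * g' x \<partial>P) - (\<integral>x. h x * g' x \<partial>Q)\<bar> \<le> e"
    using hb' by (intro close) auto
  moreover have "\<bar>(\<integral>x. h x * indicator A x \<partial>P) - (\<integral>x. h x * indicator A x \<partial>Q)\<bar> \<le> e"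
    using hb' by (intro close) auto
  ultimately show ?thesis by linarith
qed

text \<open>
  With \<open>a'\<close>, \<open>b'\<close>, \<open>c'\<close> versions under \<open>P\<close>, the defect \<open>\<bar>c - a b\<bar>\<close> is at most
  \<open>\<bar>c' - c\<bar> + \<bar>c' - a' b'\<bar> + \<bar>a' - a\<bar> + \<bar>b' - b\<bar>\<close>.  Three of these terms contribute \<open>2 e\<close> each;
  the remaining one has integral \<open>0\<close> under \<open>P\<close>, hence at most \<open>e\<close> under \<open>Q\<close>.
\<close>

lemma cond_indep_defect:
  assumes A: "A \<in> sets Q" and B: "B \<in> sets Q"
    and a: "cond_prob_version Q H A a" and b: "cond_prob_version Q H B b"
    and c: "cond_prob_version Q H (A \<inter> B) c"
    and indep: "AE x in P. sub_cond_prob P H (A \<inter> B) x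
                  = sub_cond_prob P H A x * sub_cond_prob P H B x"
  shows "(\<integral>x. \<bar>c x - a x * b x\<bar> \<partial>Q) \<le> 7 * e"
proof -
  have C: "A \<inter> B \<in> sets Q" using A B by auto
  obtain a' b' c' where a': "cond_prob_version P H A a'" and b': "cond_prob_version P H B b'"
    and c': "cond_prob_version P H (A \<inter> B) c'"
    using ex_cond_prob_version[OF P.prob_space_axioms subP] A B C unfolding sets_eq by metis
  have bd: "0 \<le> a x" "a x \<le> 1" "0 \<le> b x" "b x \<le> 1" "0 \<le> c x" "c x \<le> 1"
    "0 \<le> a' x" "a' x \<le> 1" "0 \<le> b' x" "b' x \<le> 1" "0 \<le> c' x" "c' x \<le> 1" for x
    using a b c a' b' c' by (auto simp: cond_prob_version_def)
  have [measurable]: "a \<in> borel_measurable Q" "b \<in> borel_measurable Q" "c \<in> borel_measurable Q"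
    "a' \<in> borel_measurable Q" "b' \<in> borel_measurable Q" "c' \<in> borel_measurable Q"
    using a b c a' b' c'
    by (auto simp: cond_prob_version_def intro: measurable_from_subalg[OF subQ])
  have abs01: "\<bar>u - v\<bar> \<le> 1" if "0 \<le> u" "u \<le> 1" "0 \<le> v" "v \<le> 1" for u v :: real
    using that by linarith
  have prod01: "0 \<le> a x * b x" "a x * b x \<le> 1" "0 \<le> a' x * b' x" "a' x * b' x \<le> 1" for x
    using bd[of x] by (auto intro: mult_le_one)
  have int: "integrable Q (\<lambda>x. \<bar>c x - a x * b x\<bar>)" "integrable Q (\<lambda>x. \<bar>c' x - c x\<bar>)"
    "integrable Q (\<lambda>x. \<bar>c' x - a' x * b' x\<bar>)" "integrable Q (\<lambda>x. \<bar>a' x - a x\<bar>)"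
    "integrable Q (\<lambda>x. \<bar>b' x - b x\<bar>)"
    by (rule Q.integrable_const_bound[where B = 1]; simp add: abs01 bd prod01)+
  have pointwise: "\<bar>c x - a x * b x\<bar>
      \<le> (\<bar>c' x - c x\<bar> + \<bar>c' x - a' x * b' x\<bar>) + (\<bar>a' x - a x\<bar> + \<bar>b' x - b x\<bar>)" for x
  proof -
    have "a' x * b' x - a x * b x = (a' x - a x) * b' x + a x * (b' x - b x)"
      by (simp add: algebra_simps)
    moreover have "\<bar>(a' x - a x) * b' x\<bar> \<le> \<bar>a' x - a x\<bar>" "\<bar>a x * (b' x - b x)\<bar> \<le> \<bar>b' x - b x\<bar>"
      using bd[of x] by (auto simp: abs_mult intro: mult_left_le mult_left_le_one_le)
    ultimately show ?thesis by linarith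
  qed
  have "(\<integral>x. \<bar>c x - a x * b x\<bar> \<partial>Q)
      \<le> (\<integral>x. (\<bar>c' x - c x\<bar> + \<bar>c' x - a' x * b' x\<bar>) + (\<bar>a' x - a x\<bar> + \<bar>b' x - b x\<bar>) \<partial>Q)"
    using int pointwise by (intro integral_mono) auto
  also have "\<dots> = ((\<integral>x. \<bar>c' x - c x\<bar> \<partial>Q) + (\<integral>x. \<bar>c' x - a' x * b' x\<bar> \<partial>Q))
      + ((\<integral>x. \<bar>a' x - a x\<bar> \<partial>Q) + (\<integral>x. \<bar>b' x - b x\<bar> \<partial>Q))"
    using int by simp
  finally have "(\<integral>x. \<bar>c x - a x * b x\<bar> \<partial>Q)
      \<le> ((\<integral>x. \<bar>c' x - c x\<bar> \<partial>Q) + (\<integral>x. \<bar>c' x - a' x * b' x\<bar> \<partial>Q))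
      + ((\<integral>x. \<bar>a' x - a x\<bar> \<partial>Q) + (\<integral>x. \<bar>b' x - b x\<bar> \<partial>Q))" .
  moreover have "(\<integral>x. \<bar>c' x - a' x * b' x\<bar> \<partial>Q) \<le> e"
  proof -
    have "AE x in P. c' x = a' x * b' x"
      using indep a' b' c' unfolding cond_prob_version_def by auto
    then have "(\<integral>x. \<bar>c' x - a' x * b' x\<bar> \<partial>P) = 0"
      by (intro integral_eq_zero_AE) auto
    moreover have "\<bar>(\<integral>x. \<bar>c' x - a' x * b' x\<bar> \<partial>P) - (\<integral>x. \<bar>c' x - a' x * b' x\<bar> \<partial>Q)\<bar> \<le> e"
      using bd prod01 by (intro close) (auto intro: abs01)
    ultimately show ?thesis by linarith
  qed
  ultimately show ?thesis
    using cond_prob_L1_dist[OF A a' a] cond_prob_L1_dist[OF B b' b] cond_prob_L1_dist[OF C c' c]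
    by linarith
qed

end

section \<open>Convergence of densities\<close>

lemma prob_space_density_of_prob_density:
  assumes "prob_density M f"
  shows "prob_space (density M (\<lambda>x. ennreal (f x)))"
proof
  have [measurable]: "f \<in> borel_measurable M" using assms by (simp add: prob_density_def)
  have "(\<integral>\<^sup>+x. ennreal (f x) \<partial>M) = ennreal (\<integral>x. f x \<partial>M)"
    using assms by (intro nn_integral_eq_integral) (auto simp: prob_density_def)
  then show "emeasure (density M (\<lambda>x. ennreal (f x))) (space (density M (\<lambda>x. ennreal (f x)))) = 1"
    using assms by (simp add: emeasure_density prob_density_def cong: nn_integral_cong)
qed

lemma density_tv_close:
  assumes f: "prob_density M f" and g: "prob_density M g" and sub: "subalgebra M H"
  shows "tv_close (density M (\<lambda>x. ennreal (f x))) (density M (\<lambda>x. ennreal (g x))) H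
           (\<integral>x. \<bar>f x - g x\<bar> \<partial>M)"
proof -
  interpret P: prob_space "density M (\<lambda>x. ennreal (f x))"
    by (rule prob_space_density_of_prob_density) fact
  interpret Q: prob_space "density M (\<lambda>x. ennreal (g x))"
    by (rule prob_space_density_of_prob_density) fact
  have [measurable]: "f \<in> borel_measurable M" "g \<in> borel_measurable M"
    and int: "integrable M f" "integrable M g"
    and nn: "AE x in M. 0 \<le> f x" "AE x in M. 0 \<le> g x"
    using f g by (auto simp: prob_density_def)
  show ?thesis
  proof
    fix \<phi> :: "'a \<Rightarrow> real"
    assume "\<phi> \<in> borel_measurable (density M (\<lambda>x. ennreal (g x)))" and bd: "\<And>x. \<bar>\<phi> x\<bar> \<le> 1"
    then have [measurable]: "\<phi> \<in> borel_measurable M" by simp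
    have i: "integrable M (\<lambda>x. f x * \<phi> x)" "integrable M (\<lambda>x. g x * \<phi> x)"
      by (rule Bochner_Integration.integrable_bound[OF int(1)]
            Bochner_Integration.integrable_bound[OF int(2)];
          auto simp: abs_mult intro!: mult_left_le bd)+
    have "(\<integral>x. \<phi> x \<partial>density M (\<lambda>x. ennreal (f x))) - (\<integral>x. \<phi> x \<partial>density M (\<lambda>x. ennreal (g x)))
        = (\<integral>x. f x * \<phi> x \<partial>M) - (\<integral>x. g x * \<phi> x \<partial>M)"
      using nn by (simp add: integral_density)
    also have "\<dots> = (\<integral>x. (f x - g x) * \<phi> x \<partial>M)"
      using i by (simp add: left_diff_distrib)
    finally have eq: "(\<integral>x. \<phi> x \<partial>density M (\<lambda>x. ennreal (f x)))
        - (\<integral>x. \<phi> x \<partial>density M (\<lambda>x. ennreal (g x))) = (\<integral>x. (f x - g x) * \<phi> x \<partial>M)" .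
    have "\<bar>\<integral>x. (f x - g x) * \<phi> x \<partial>M\<bar> \<le> (\<integral>x. \<bar>(f x - g x) * \<phi> x\<bar> \<partial>M)"
      by (rule integral_abs_bound)
    also have "\<dots> \<le> (\<integral>x. \<bar>f x - g x\<bar> \<partial>M)"
    proof (rule integral_mono)
      show "integrable M (\<lambda>x. \<bar>(f x - g x) * \<phi> x\<bar>)"
        using i by (simp add: left_diff_distrib)
      show "\<bar>(f x - g x) * \<phi> x\<bar> \<le> \<bar>f x - g x\<bar>" for x
        by (simp add: abs_mult mult_left_le bd)
    qed (use int in simp)
    finally show "\<bar>(\<integral>x. \<phi> x \<partial>density M (\<lambda>x. ennreal (f x)))
        - (\<integral>x. \<phi> x \<partial>density M (\<lambda>x. ennreal (g x)))\<bar> \<le> (\<integral>x. \<bar>f x - g x\<bar> \<partial>M)"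
      unfolding eq .
  qed (use sub in \<open>auto simp: subalgebra_def\<close>)
qed

text \<open>
  Scheffe's lemma needs the \<open>L\<^sup>1\<close> norms of \<open>F n\<close> not to exceed that of \<open>f\<close>; here all of them
  equal \<open>1\<close>.
\<close>

lemma Scheffe_prob_density:
  assumes F: "\<And>n. prob_density M (F n)" and f: "prob_density M f"
    and lim: "AE x in M. (\<lambda>n. F n x) \<longlonglongrightarrow> f x"
  shows "(\<lambda>n. \<integral>x. \<bar>F n x - f x\<bar> \<partial>M) \<longlonglongrightarrow> 0"
proof -
  have norm1: "(\<integral>\<^sup>+x. norm (g x) \<partial>M) = 1" if "prob_density M g" for g
  proof -
    have "(\<integral>\<^sup>+x. norm (g x) \<partial>M) = (\<integral>\<^sup>+x. ennreal (g x) \<partial>M)"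
      using that by (intro nn_integral_cong) (auto simp: prob_density_def)
    also have "\<dots> = ennreal (\<integral>x. g x \<partial>M)"
      using that by (intro nn_integral_eq_integral) (auto simp: prob_density_def)
    finally show ?thesis using that by (simp add: prob_density_def)
  qed
  have int: "integrable M (F n)" "integrable M f" for n
    using F f by (auto simp: prob_density_def)
  have "(\<lambda>n. \<integral>\<^sup>+x. norm (F n x - f x) \<partial>M) \<longlonglongrightarrow> 0"
    using int F f by (intro Scheffe_lemma2 lim) (auto simp: norm1 simp del: real_norm_def)
  moreover have "(\<integral>\<^sup>+x. norm (F n x - f x) \<partial>M) = ennreal (\<integral>x. \<bar>F n x - f x\<bar> \<partial>M)" for n
    using int by (subst nn_integral_eq_integral) auto
  ultimately have "(\<lambda>n. ennreal (\<integral>x. \<bar>F n x - f x\<bar> \<partial>M)) \<longlonglongrightarrow> ennreal 0" by simp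
  then show ?thesis by (subst (asm) tendsto_ennreal_iff) auto
qed

section \<open>Conditional independence in the limit\<close>

theorem corollary1:
  fixes \<mu> :: "'a measure"
    and P :: "nat \<Rightarrow> 'a measure" and P_lim :: "'a measure"
    and f :: "nat \<Rightarrow> 'a \<Rightarrow> real" and f_lim :: "'a \<Rightarrow> real"
    and \<A> \<B> H :: "'a measure"
  assumes "sigma_finite_measure \<mu>"
    and "\<And>n. prob_space (P n)"
    and "\<And>n. prob_density \<mu> (f n)"
    and "\<And>n. P n = density \<mu> (\<lambda>x. ennreal (f n x))"
    and "prob_density \<mu> f_lim"
    and "AE x in \<mu>. (\<lambda>n. f n x) \<longlonglongrightarrow> f_lim x"
    and "P_lim = density \<mu> (\<lambda>x. ennreal (f_lim x))"
    and "subalgebra \<mu> \<A>" and "subalgebra \<mu> \<B>" and "subalgebra \<mu> H"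
    and "\<And>n. cond_indep_subalg (P n) H \<A> \<B>"
  shows "cond_indep_subalg P_lim H \<A> \<B>"
  unfolding cond_indep_subalg_def
proof (intro ballI)
  fix A B assume AB: "A \<in> sets \<A>" "B \<in> sets \<B>"
  define e where "e n = (\<integral>x. \<bar>f n x - f_lim x\<bar> \<partial>\<mu>)" for n
  have e: "e \<longlonglongrightarrow> 0"
    unfolding e_def using assms(3,5,6) by (rule Scheffe_prob_density)
  have close: "tv_close (P n) P_lim H (e n)" for n
    unfolding assms(4) assms(7) e_def using assms(3,5,10) by (intro density_tv_close)
  have A: "A \<in> sets P_lim" and B: "B \<in> sets P_lim"
    using AB assms(8,9) by (auto simp: assms(7) subalgebra_def)
  interpret L: prob_space P_lim
    unfolding assms(7) by (rule prob_space_density_of_prob_density) fact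
  have sub: "subalgebra P_lim H"
    using assms(10) by (simp add: assms(7) subalgebra_def)
  obtain a b c where ver: "cond_prob_version P_lim H A a" "cond_prob_version P_lim H B b"
      "cond_prob_version P_lim H (A \<inter> B) c"
    using ex_cond_prob_version[OF L.prob_space_axioms sub] A B by (metis sets.Int)
  have [measurable]: "a \<in> borel_measurable P_lim" "b \<in> borel_measurable P_lim"
      "c \<in> borel_measurable P_lim"
    using ver by (auto simp: cond_prob_version_def intro: measurable_from_subalg[OF sub])
  have le: "(\<integral>x. \<bar>c x - a x * b x\<bar> \<partial>P_lim) \<le> 7 * e n" for n
    using tv_close.cond_indep_defect[OF close A B ver] assms(11)[of n] AB
    unfolding cond_indep_subalg_def by blast
  have "(\<integral>x. \<bar>c x - a x * b x\<bar> \<partial>P_lim) \<le> 0"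
    using LIMSEQ_le_const[OF tendsto_mult_right_zero[OF e, of 7]] le by blast
  then have zero: "(\<integral>x. \<bar>c x - a x * b x\<bar> \<partial>P_lim) = 0"
    by (intro antisym) auto
  have "\<bar>c x - a x * b x\<bar> \<le> 1" for x
  proof -
    have "0 \<le> a x * b x" "a x * b x \<le> 1" "0 \<le> c x" "c x \<le> 1"
      using ver by (auto simp: cond_prob_version_def intro: mult_le_one)
    then show ?thesis by linarith
  qed
  then have "integrable P_lim (\<lambda>x. \<bar>c x - a x * b x\<bar>)"
    by (intro L.integrable_const_bound[where B = 1]) auto
  then have "AE x in P_lim. c x = a x * b x"
    using zero by (subst (asm) integral_nonneg_eq_0_iff_AE) auto
  then show "AE x in P_lim. sub_cond_prob P_lim H (A \<inter> B) x
      = sub_cond_prob P_lim H A x * sub_cond_prob P_lim H B x"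
    using ver unfolding cond_prob_version_def by auto
qed

end
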